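(* Let $\mathcal{H}_N$ be an $N$-dimensional Hilbert space with orthonormal basis $\{e_i\}_{i=1}^N$, and let $W$ be a $k$-dimensional subspace of $\mathcal{H}_N$. Then there is a subset $K\subset\{1,2,\ldots,N\}$ with $|K|=k$ and a (not necessarily orthogonal) projection $\mathcal{P}_W$ onto $W$ such that the matrix of $\mathcal{P}_W^*\mathcal{P}_W$ with respect to $\{e_i\}_{i=1}^N$ has non-zero entries only in the entries of $K\times K$; that is, $\langle \mathcal{P}_W^*\mathcal{P}_W e_i,e_j\rangle=0$ whenever $(i,j)\notin K\times K$.
   Context: A (non-orthogonal) projection onto a subspace $W$ of a Hilbert space $\mathcal{H}$ is a linear map $\mathcal{P}_W$ from $\mathcal{H}$ onto $W$ with $\mathcal{P}_W^2=\mathcal{P}_W$; it is not required to be self-adjoint (orthogonal projections are allowed as a special case). $\mathcal{P}_W^*$ is its adjoint. *)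

theory Defs
  imports "HOL-Analysis.Analysis"
begin

text \<open>Scalars of a Hilbert space: a normed field over the reals with a conjugation satisfying
  \<open>x * cj x = \<bar>x\<bar>\<^sup>2\<close>. Both \<^typ>\<open>real\<close> (with the identity) and \<^typ>\<open>complex\<close> (with \<^const>\<open>cnj\<close>) are
  instances, and up to isomorphism they are the only ones, so a statement about
  \<open>'k::hilbert_scalar\<close> covers exactly the real and the complex case.\<close>

class hilbert_scalar = real_normed_field +
  fixes cj :: "'a \<Rightarrow> 'a"
  assumes cj_add: "cj (x + y) = cj x + cj y"
    and cj_mult: "cj (x * y) = cj x * cj y"
    and mult_cj: "x * cj x = scaleR ((norm x)\<^sup>2) 1"

instantiation real :: hilbert_scalar
begin
definition cj_real :: "real \<Rightarrow> real" where "cj_real x = x"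
instance
  by standard (simp_all add: cj_real_def power2_eq_square)
end

instantiation complex :: hilbert_scalar
begin
definition cj_complex :: "complex \<Rightarrow> complex" where "cj_complex = cnj"
instance
  by standard (simp_all add: cj_complex_def complex_norm_square[symmetric] scaleR_conv_of_real del: of_real_power)
end

text \<open>The whole type \<open>'a\<close> is the Hilbert space. The inner product is linear in the first and
  conjugate-linear in the second argument. \<open>ip x x\<close> is a nonnegative real by \<open>ip_pos\<close>, so the norm
  below is the usual one.\<close>

definition ip_norm :: "('a \<Rightarrow> 'a \<Rightarrow> 'k::hilbert_scalar) \<Rightarrow> 'a \<Rightarrow> real"
  where "ip_norm ip x = sqrt (norm (ip x x))"

locale hilbert_space = vector_space smul
  for smul :: "'k::hilbert_scalar \<Rightarrow> 'a::ab_group_add \<Rightarrow> 'a" +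
  fixes ip :: "'a \<Rightarrow> 'a \<Rightarrow> 'k"
  assumes ip_add_left: "ip (x + y) z = ip x z + ip y z"
    and ip_scale_left: "ip (smul c x) y = c * ip x y"
    and ip_commute: "ip y x = cj (ip x y)"
    and ip_pos: "x \<noteq> 0 \<Longrightarrow> \<exists>r>0. ip x x = of_real r"
    and ip_complete: "(\<And>\<epsilon>. \<epsilon> > 0 \<Longrightarrow> \<exists>M. \<forall>m\<ge>M. \<forall>n\<ge>M. ip_norm ip (X m - X n) < \<epsilon>) \<Longrightarrow>
          \<exists>l. (\<lambda>n::nat. ip_norm ip (X n - l)) \<longlonglongrightarrow> 0"

definition orthonormal_basis_on ::
    "('k::hilbert_scalar \<Rightarrow> 'a::ab_group_add \<Rightarrow> 'a) \<Rightarrow> ('a \<Rightarrow> 'a \<Rightarrow> 'k) \<Rightarrow> 'i set \<Rightarrow> ('i \<Rightarrow> 'a) \<Rightarrow> bool"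
  where "orthonormal_basis_on smul ip I e \<longleftrightarrow>
    (\<forall>i\<in>I. \<forall>j\<in>I. ip (e i) (e j) = (if i = j then 1 else 0)) \<and> module.span smul (e ` I) = UNIV"

text \<open>Meaningful when the adjoint exists (for instance for every linear map on a finite-dimensional
  space); it is then unique because \<open>ip\<close> is positive definite.\<close>

definition hilbert_adjoint :: "('a \<Rightarrow> 'a \<Rightarrow> 'k::hilbert_scalar) \<Rightarrow> ('a \<Rightarrow> 'a) \<Rightarrow> 'a \<Rightarrow> 'a"
  where "hilbert_adjoint ip T = (THE S. \<forall>x y. ip (T x) y = ip x (S y))"

definition projection_onto ::
    "('k::field \<Rightarrow> 'a::ab_group_add \<Rightarrow> 'a) \<Rightarrow> 'a set \<Rightarrow> ('a \<Rightarrow> 'a) \<Rightarrow> bool"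
  where "projection_onto smul W P \<longleftrightarrow>
    Vector_Spaces.linear smul smul P \<and> range P = W \<and> P \<circ> P = P"

end

theory Submission
  imports Defs
begin

text \<open>
  Since \<open>\<langle>P\<^sup>* P e\<^sub>i, e\<^sub>j\<rangle> = \<langle>P e\<^sub>i, P e\<^sub>j\<rangle>\<close>, an entry of the matrix vanishes as soon as \<open>P\<close> kills
  \<open>e\<^sub>i\<close> or \<open>e\<^sub>j\<close>. It therefore suffices to find a projection onto \<open>W\<close> that kills \<open>N - k\<close> of the
  basis vectors. By Steinitz exchange, a basis of \<open>W\<close> extends to a basis of the whole space by
  \<open>N - k\<close> of the \<open>e\<^sub>i\<close>; these span a complement of \<open>W\<close>, and \<open>P\<close> is the projection onto \<open>W\<close> along this
  complement (\<open>projection_killing_spanning_vectors\<close>). The remaining \<open>k\<close> indices form \<open>K\<close>.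

  The adjoint is a definite description, so the identity above requires that an adjoint exists and
  is unique. Existence is the finite-dimensional Riesz formula
  \<open>T\<^sup>* y = \<Sum>\<^sub>i \<langle>y, T e\<^sub>i\<rangle> e\<^sub>i\<close>, and uniqueness is definiteness of the inner product
  (\<open>hilbert_adjoint_eq\<close>).
\<close>

lemma cj_zero: "cj (0::'k::hilbert_scalar) = 0"
  using cj_add[of "0::'k" 0] by simp

context vector_space
begin

text \<open>Steinitz exchange in the form of a projection: a basis of \<open>W\<close> is completed by vectors \<open>F\<close> taken
  from the spanning set, and the projection is the linear map that fixes the basis of \<open>W\<close> and
  sends \<open>F\<close> to zero.\<close>

lemma projection_killing_spanning_vectors:
  assumes "finite E" and "span E = UNIV" and "subspace W"
  obtains P F where "projection_onto scale W P" "F \<subseteq> E"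
    "card F + dim W = dim UNIV" "\<And>x. x \<in> F \<Longrightarrow> P x = 0"
proof -
  interpret endo: vector_space_pair scale scale ..
  obtain S where S: "S \<subseteq> W" "independent S" "W \<subseteq> span S" "card S = dim W"
    by (rule basis_exists)
  then have span_S: "span S = W"
    using span_minimal[OF S(1) assms(3)] by blast
  obtain B where B: "S \<subseteq> B" "B \<subseteq> S \<union> E" "independent B" "S \<union> E \<subseteq> span B"
    using maximal_independent_subset_extend[of S "S \<union> E"] S(2) by blast
  then have span_B: "span B = UNIV"
    using assms(2) span_minimal[OF _ subspace_span, of E B] by auto
  have "finite B"
    using independent_span_bound[OF assms(1) B(3)] assms(2) by simp
  have card_B: "card B = dim UNIV"
    using B(3) span_B by (intro basis_card_eq_dim) auto
  obtain P where P: "Vector_Spaces.linear scale scale P"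
      "\<forall>x\<in>B. P x = (if x \<in> S then x else 0)"
    using endo.linear_independent_extend[OF B(3), of "\<lambda>x. if x \<in> S then x else 0"] by blast
  interpret P: Vector_Spaces.linear scale scale P by fact
  have fixes_W: "P x = x" if "x \<in> W" for x
    by (rule endo.linear_eq_on[OF P(1) linear_ident, of x S])
      (use that P(2) B(1) span_S in auto)
  have into_W: "P x \<in> W" for x
  proof -
    have "P ` span B = span (P ` B)" by (rule P.span_image[symmetric])
    also have "\<dots> \<subseteq> W"
      using P(2) S(1) assms(3) by (intro span_minimal) (auto simp: subspace_0)
    finally show ?thesis using span_B by auto
  qed
  have "range P = W"
  proof
    show "range P \<subseteq> W" using into_W by blast
    show "W \<subseteq> range P" using fixes_W by (metis rangeI subsetI)
  qed
  then have "projection_onto scale W P"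
    using P(1) fixes_W[OF into_W] by (simp add: projection_onto_def fun_eq_iff)
  moreover have "B - S \<subseteq> E" using B(2) by blast
  moreover have "card (B - S) + dim W = dim UNIV"
    using card_B S(4) B(1) \<open>finite B\<close> card_mono[OF \<open>finite B\<close> B(1)]
    by (simp add: card_Diff_subset finite_subset)
  moreover have "P x = 0" if "x \<in> B - S" for x
    using that P(2) by simp
  ultimately show thesis by (rule that)
qed

end

context hilbert_space
begin

lemma ip_zero_left: "ip 0 y = 0"
  using ip_add_left[of 0 0 y] by simp

lemma ip_zero_right: "ip x 0 = 0"
  using ip_commute[of x 0] by (simp add: ip_zero_left cj_zero)

lemma ip_diff_right: "ip x (y - z) = ip x y - ip x z"
proof -
  have "ip x y = cj (ip ((y - z) + z) x)" using ip_commute[of x y] by simp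
  also have "\<dots> = cj (ip (y - z) x) + cj (ip z x)" by (simp only: ip_add_left cj_add)
  also have "\<dots> = ip x (y - z) + ip x z" by (simp only: ip_commute[symmetric])
  finally have "ip x y = ip x (y - z) + ip x z" .
  then show ?thesis by simp
qed

lemma ip_sum_left: "ip (sum f A) z = (\<Sum>i\<in>A. ip (f i) z)"
  by (induction A rule: infinite_finite_induct) (auto simp: ip_zero_left ip_add_left)

lemma ip_eq_zeroD: "ip x x = 0 \<Longrightarrow> x = 0"
  using ip_pos[of x] by auto

lemma ip_right_cancel:
  assumes "\<And>x. ip x y = ip x z"
  shows "y = z"
  using ip_eq_zeroD[of "y - z"] assms by (simp add: ip_diff_right)

text \<open>For fixed \<open>y\<close>, both sides are linear in \<open>x\<close>, so they agree once they agree on the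
  orthonormal basis, where the formula for \<open>T\<^sup>* y\<close> is designed to make them agree.\<close>

lemma adjoint_exists:
  assumes "finite I" and onb: "orthonormal_basis_on smul ip I e"
    and "Vector_Spaces.linear smul smul T"
  shows "\<exists>S. \<forall>x y. ip (T x) y = ip x (S y)"
proof -
  interpret T: Vector_Spaces.linear smul smul T by fact
  define S where "S y = (\<Sum>i\<in>I. smul (ip y (T (e i))) (e i))" for y
  have basis: "ip (T (e j)) y = ip (e j) (S y)" if "j \<in> I" for j y
  proof -
    have "ip (S y) (e j) = (\<Sum>i\<in>I. ip y (T (e i)) * ip (e i) (e j))"
      by (simp add: S_def ip_sum_left ip_scale_left)
    also have "\<dots> = (\<Sum>i\<in>I. if i = j then ip y (T (e i)) else 0)"
      using onb that by (intro sum.cong) (auto simp: orthonormal_basis_on_def)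
    also have "\<dots> = ip y (T (e j))" using that assms(1) by simp
    finally have "cj (ip (S y) (e j)) = cj (ip y (T (e j)))" by (rule arg_cong)
    then show ?thesis by (simp only: ip_commute[symmetric])
  qed
  have "ip (T x) y = ip x (S y)" for x y
  proof -
    have "x \<in> span (e ` I)" using onb by (simp add: orthonormal_basis_on_def)
    then show ?thesis
      by (induction rule: span_induct_alt)
        (auto simp: T.zero T.add T.scale ip_zero_left ip_add_left ip_scale_left basis)
  qed
  then show ?thesis by blast
qed

lemma hilbert_adjoint_eq:
  assumes "finite I" and "orthonormal_basis_on smul ip I e"
    and "Vector_Spaces.linear smul smul T"
  shows "ip (T x) y = ip x (hilbert_adjoint ip T y)"
proof -
  have "\<exists>!S. \<forall>x y. ip (T x) y = ip x (S y)"
  proof (rule ex_ex1I)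
    show "\<exists>S. \<forall>x y. ip (T x) y = ip x (S y)" by (rule adjoint_exists[OF assms])
    fix S S' assume *: "\<forall>x y. ip (T x) y = ip x (S y)" "\<forall>x y. ip (T x) y = ip x (S' y)"
    have "ip x (S y) = ip x (S' y)" for x y
      using *(1)[rule_format, of x y] *(2)[rule_format, of x y] by (rule trans[OF sym])
    then show "S = S'" by (intro ext ip_right_cancel)
  qed
  from theI'[OF this] have "\<forall>x y. ip (T x) y = ip x (hilbert_adjoint ip T y)"
    unfolding hilbert_adjoint_def .
  then show ?thesis by blast
qed

lemma orthonormal_inj_on:
  assumes "orthonormal_basis_on smul ip I e"
  shows "inj_on e I"
proof (rule inj_onI, rule ccontr)
  fix i j assume ij: "i \<in> I" "j \<in> I" "e i = e j" "i \<noteq> j"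
  have gram: "ip (e a) (e b) = (if a = b then 1 else 0)" if "a \<in> I" "b \<in> I" for a b
    using assms that by (simp add: orthonormal_basis_on_def)
  have "ip (e i) (e i) = 1" using gram[OF ij(1,1)] by simp
  moreover have "ip (e i) (e j) = 0" using gram[OF ij(1,2)] ij(4) by simp
  ultimately show False using ij(3) by simp
qed

end

theorem proposition4p1:
  fixes smul :: "'k::hilbert_scalar \<Rightarrow> 'a::ab_group_add \<Rightarrow> 'a"
    and ip :: "'a \<Rightarrow> 'a \<Rightarrow> 'k"
    and e :: "nat \<Rightarrow> 'a"
    and W :: "'a set"
    and N k :: nat
  assumes "hilbert_space smul ip"
    and "vector_space.dim smul (UNIV :: 'a set) = N"
    and "orthonormal_basis_on smul ip {1..N} e"
    and "module.subspace smul W"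
    and "vector_space.dim smul W = k"
  shows "\<exists>K P. K \<subseteq> {1..N} \<and> card K = k \<and> projection_onto smul W P \<and>
    (\<forall>i\<in>{1..N}. \<forall>j\<in>{1..N}. (i, j) \<notin> K \<times> K \<longrightarrow>
       ip (hilbert_adjoint ip P (P (e i))) (e j) = 0)"
proof -
  interpret hilbert_space smul ip by fact
  have "span (e ` {1..N}) = UNIV"
    using assms(3) by (simp add: orthonormal_basis_on_def)
  then obtain P F where P: "projection_onto smul W P" and F: "F \<subseteq> e ` {1..N}"
      "card F + dim W = dim UNIV" and kills: "\<And>x. x \<in> F \<Longrightarrow> P x = 0"
    using projection_killing_spanning_vectors[of "e ` {1..N}" W] assms(4) by blast
  obtain J where J: "J \<subseteq> {1..N}" "F = e ` J" using F(1) by (auto simp: subset_image_iff)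
  have "card F = card J"
    using J orthonormal_inj_on[OF assms(3)] by (simp add: card_image inj_on_subset)
  then have "card ({1..N} - J) = k"
    using F(2) J(1) assms(2,5) by (simp add: card_Diff_subset finite_subset)
  moreover have "ip (hilbert_adjoint ip P (P (e i))) (e j) = 0"
    if "i \<in> {1..N}" "j \<in> {1..N}" "(i, j) \<notin> ({1..N} - J) \<times> ({1..N} - J)" for i j
  proof -
    have "P (e i) = 0 \<or> P (e j) = 0" using that J(2) kills by auto
    then have "ip (P (e j)) (P (e i)) = 0" by (auto simp: ip_zero_left ip_zero_right)
    moreover have "ip (P (e j)) (P (e i)) = ip (e j) (hilbert_adjoint ip P (P (e i)))"
      using P by (intro hilbert_adjoint_eq[OF _ assms(3)]) (auto simp: projection_onto_def)
    ultimately have "ip (e j) (hilbert_adjoint ip P (P (e i))) = 0" by simp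
    then show ?thesis by (subst ip_commute) (simp add: cj_zero)
  qed
  ultimately show ?thesis
    using P by (intro exI[of _ "{1..N} - J"] exI[of _ P]) auto
qed

end
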